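(* Let $X$ be a countably infinite set and $\Sigma$ a non-empty finite subset of $X$. Then the maximal inverse subsemigroups of $I_X$ which contain the pointwise stabiliser $\operatorname{Sym}(X)_{(\Sigma)}$ but not $\operatorname{Sym}(X)$ are exactly the following, where $\Gamma$ ranges over the non-empty subsets of $\Sigma$: $\mathcal{P}_\Gamma = \{ f \in I_X \mid (\Gamma \not\subseteq \operatorname{dom}(f) \text{ and } \Gamma \not\subseteq \operatorname{im}(f)) \text{ or } \Gamma f = \Gamma \} \cup \mathfrak{F}_X$; $\mathcal{Q}_\Gamma$, the set of all $f \in I_X$ satisfying at least one of the following: (a) $\Gamma \not\subseteq \operatorname{dom}(f)$ and $\Gamma \not\subseteq \operatorname{im}(f)$; (b) $\Gamma \not\subseteq \operatorname{dom}(f)$ and $d(f) = \aleph_0$; (c) $\Gamma \not\subseteq \operatorname{im}(f)$ and $c(f) = \aleph_0$; (d) $\Gamma f = \Gamma$ and $c(f) + d(f) < \aleph_0$; (e) $c(f) = d(f) = \aleph_0$.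
   Context: For a set $X$, $I_X$ is the symmetric inverse monoid: the set of all bijections between subsets of $X$ (partial bijections, called charts) under composition of partial functions, written left to right (the image of $x$ under $f$ is $xf$). For $\Gamma \subseteq X$, $\Gamma f = \{ xf \mid x \in \Gamma \cap \operatorname{dom}(f)\}$. $\operatorname{Sym}(X) \subseteq I_X$ is the group of all permutations of $X$, and $\operatorname{Sym}(X)_{(\Sigma)} = \{ f \in \operatorname{Sym}(X) \mid yf = y \text{ for all } y \in \Sigma\}$. For $f \in I_X$, the defect is $d(f) = |X \setminus \operatorname{im}(f)|$ and the collapse is $c(f) = |X \setminus \operatorname{dom}(f)|$. $\mathfrak{F}_X = \{ f \in I_X \mid |\operatorname{im}(f)| < |X| \}$ (for countably infinite $X$: the charts with finite domain). An inverse subsemigroup of $I_X$ is a subsemigroup closed under $f\mapsto f^{-1}$; a maximal inverse subsemigroup of $I_X$ is a proper inverse subsemigroup that is maximal under containment among the proper inverse subsemigroups of $I_X$. *)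

theory Defs
  imports Main "HOL-Library.Countable_Set"
begin

unbundle cardinal_syntax

text \<open>
  Partial functions are represented by their graphs. Hence \<open>Domain f\<close> and \<open>Range f\<close> are the
  domain and the image of a chart \<open>f\<close>, \<open>f `` \<Gamma>\<close> is the image of \<open>\<Gamma>\<close> under \<open>f\<close> (points of \<open>\<Gamma>\<close>
  outside the domain are ignored), \<open>f O g\<close> is the composition written left to right
  (first \<open>f\<close>, then \<open>g\<close>), and \<open>f\<inverse>\<close> is the inverse chart.
\<close>

definition sym_inv_monoid :: "'a set \<Rightarrow> ('a \<times> 'a) set set" where
  "sym_inv_monoid X = {f. f \<subseteq> X \<times> X \<and> single_valued f \<and> single_valued (f\<inverse>)}"

definition Sym :: "'a set \<Rightarrow> ('a \<times> 'a) set set" where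
  "Sym X = {f \<in> sym_inv_monoid X. Domain f = X \<and> Range f = X}"

definition pointwise_stabiliser :: "'a set \<Rightarrow> 'a set \<Rightarrow> ('a \<times> 'a) set set" where
  "pointwise_stabiliser X \<Sigma> = {f \<in> Sym X. \<forall>y\<in>\<Sigma>. (y, y) \<in> f}"

definition defect :: "'a set \<Rightarrow> ('a \<times> 'a) set \<Rightarrow> 'a rel" where
  "defect X f = |X - Range f|"

definition collapse :: "'a set \<Rightarrow> ('a \<times> 'a) set \<Rightarrow> 'a rel" where
  "collapse X f = |X - Domain f|"

definition small_charts :: "'a set \<Rightarrow> ('a \<times> 'a) set set" where
  "small_charts X = {f \<in> sym_inv_monoid X. |Range f| <o |X|}"

definition inverse_subsemigroup :: "'a set \<Rightarrow> ('a \<times> 'a) set set \<Rightarrow> bool" where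
  "inverse_subsemigroup X M \<longleftrightarrow>
     M \<subseteq> sym_inv_monoid X \<and> (\<forall>f\<in>M. \<forall>g\<in>M. f O g \<in> M) \<and> (\<forall>f\<in>M. f\<inverse> \<in> M)"

definition maximal_inverse_subsemigroup :: "'a set \<Rightarrow> ('a \<times> 'a) set set \<Rightarrow> bool" where
  "maximal_inverse_subsemigroup X M \<longleftrightarrow>
     inverse_subsemigroup X M \<and> M \<noteq> sym_inv_monoid X \<and>
     (\<forall>N. inverse_subsemigroup X N \<and> N \<noteq> sym_inv_monoid X \<and> M \<subseteq> N \<longrightarrow> N = M)"

definition P_semigroup :: "'a set \<Rightarrow> 'a set \<Rightarrow> ('a \<times> 'a) set set" where
  "P_semigroup X \<Gamma> =
     {f \<in> sym_inv_monoid X.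
        (\<not> \<Gamma> \<subseteq> Domain f \<and> \<not> \<Gamma> \<subseteq> Range f) \<or> f `` \<Gamma> = \<Gamma>} \<union> small_charts X"

text \<open>The cardinal \<open>natLeq\<close> is \<open>\<aleph>\<^sub>0\<close>.\<close>

definition Q_semigroup :: "'a set \<Rightarrow> 'a set \<Rightarrow> ('a \<times> 'a) set set" where
  "Q_semigroup X \<Gamma> =
     {f \<in> sym_inv_monoid X.
        (\<not> \<Gamma> \<subseteq> Domain f \<and> \<not> \<Gamma> \<subseteq> Range f) \<or>
        (\<not> \<Gamma> \<subseteq> Domain f \<and> defect X f =o natLeq) \<or>
        (\<not> \<Gamma> \<subseteq> Range f \<and> collapse X f =o natLeq) \<or>
        (f `` \<Gamma> = \<Gamma> \<and> collapse X f +c defect X f <o natLeq) \<or>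
        (collapse X f =o natLeq \<and> defect X f =o natLeq)}"

end

theory Submission
  imports Defs
begin

text \<open>
  Maximality of \<open>P\<close> and \<open>Q\<close>: a larger inverse semigroup contains some \<open>f\<close> which can be
  precomposed with a chart fixing \<open>\<Gamma>\<close> pointwise to give a total chart \<open>q\<close> whose image misses a
  point of \<open>\<Gamma>\<close> or is coinfinite. Then every chart \<open>h\<close> is \<open>q (q\<^sup>-\<^sup>1 h q) q\<^sup>-\<^sup>1\<close>, and the middle
  factor is so small that it lies in \<open>P\<close> or \<open>Q\<close>.

  Conversely, let \<open>M\<close> be maximal, contain the stabiliser of \<open>\<Sigma>\<close> and not contain \<open>Sym X\<close>. The charts
  that are total exactly when they are onto form a proper inverse semigroup containing
  \<open>Sym X\<close>, so \<open>M\<close> has a total chart that is not onto. No total chart \<open>q\<close> in \<open>M\<close> has an image disjoint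
  from \<open>\<Sigma>\<close>: otherwise \<open>q\<^sup>-\<^sup>1 h q\<close>, for \<open>h\<close> in \<open>Sym X\<close>, extends by the identity to an element of the
  stabiliser. Among the total charts whose image misses a point outside \<open>\<Sigma>\<close>, choose \<open>v\<close> with
  \<open>\<Gamma> = im v \<inter> \<Sigma>\<close> as small as possible; then the image of every total chart in \<open>M\<close> contains
  \<open>\<Gamma>\<close>. If \<open>M\<close> is not inside \<open>Q\<^sub>\<Gamma>\<close>, composing with a witness gives a total chart of infinite defect;
  repeating the choice among those shows that \<open>M\<close> is inside some \<open>P\<^sub>\<Gamma>\<close>.
\<close>

section \<open>Charts\<close>

lemma chart_converse: "f \<in> sym_inv_monoid X \<Longrightarrow> f\<inverse> \<in> sym_inv_monoid X"
  by (auto simp: sym_inv_monoid_def)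

lemma chart_comp:
  "f \<in> sym_inv_monoid X \<Longrightarrow> g \<in> sym_inv_monoid X \<Longrightarrow> f O g \<in> sym_inv_monoid X"
  by (auto simp: sym_inv_monoid_def converse_relcomp intro: single_valued_relcomp)

lemma chart_unique_right:
  "f \<in> sym_inv_monoid X \<Longrightarrow> (x, y) \<in> f \<Longrightarrow> (x, z) \<in> f \<Longrightarrow> y = z"
  by (auto simp: sym_inv_monoid_def single_valued_def)

lemma chart_unique_left:
  "f \<in> sym_inv_monoid X \<Longrightarrow> (x, z) \<in> f \<Longrightarrow> (y, z) \<in> f \<Longrightarrow> x = y"
  by (auto simp: sym_inv_monoid_def single_valued_def)

lemma chart_in_carrier: "f \<in> sym_inv_monoid X \<Longrightarrow> (x, y) \<in> f \<Longrightarrow> x \<in> X \<and> y \<in> X"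
  by (auto simp: sym_inv_monoid_def)

text \<open>Passing from the graph to a function makes the facts on finiteness and cardinality under
  \<open>bij_betw\<close> available for images under charts.\<close>

lemma chart_bij_betw_Image:
  assumes f: "f \<in> sym_inv_monoid X" and A: "A \<subseteq> Domain f"
  shows "bij_betw (\<lambda>x. THE y. (x, y) \<in> f) A (f `` A)"
proof -
  have *: "(THE y. (x, y) \<in> f) = y" if "(x, y) \<in> f" for x y
    using that chart_unique_right[OF f] by blast
  have "inj_on (\<lambda>x. THE y. (x, y) \<in> f) A"
  proof (rule inj_onI)
    fix x y assume eq: "(THE z. (x, z) \<in> f) = (THE z. (y, z) \<in> f)" and "x \<in> A" "y \<in> A"
    with A obtain u v where uv: "(x, u) \<in> f" "(y, v) \<in> f" by blast
    with eq have "u = v" by (simp add: *)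
    with uv show "x = y" using chart_unique_left[OF f] by simp
  qed
  moreover have "(THE y. (x, y) \<in> f) \<in> f `` A" if "x \<in> A" for x
    using that A by (auto dest!: subsetD simp: *)
  moreover have "z \<in> (\<lambda>x. THE y. (x, y) \<in> f) ` A" if "x \<in> A" "(x, z) \<in> f" for x z
    using *[OF that(2)] that(1) by blast
  ultimately show ?thesis unfolding bij_betw_def by blast
qed

lemma chart_finite_Image_iff:
  assumes "f \<in> sym_inv_monoid X" "A \<subseteq> Domain f"
  shows "finite (f `` A) \<longleftrightarrow> finite A"
  using bij_betw_finite[OF chart_bij_betw_Image[OF assms]] by simp

lemma chart_card_Image:
  assumes "f \<in> sym_inv_monoid X" "A \<subseteq> Domain f"
  shows "card (f `` A) = card A"
  using bij_betw_same_card[OF chart_bij_betw_Image[OF assms]] by simp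

lemma chart_finite_Image:
  assumes "f \<in> sym_inv_monoid X" "finite A"
  shows "finite (f `` A)"
proof -
  have "f `` A = f `` (A \<inter> Domain f)" by blast
  then show ?thesis using chart_finite_Image_iff[OF assms(1), of "A \<inter> Domain f"] assms(2) by simp
qed

lemma chart_finite_Range_iff:
  assumes "f \<in> sym_inv_monoid X"
  shows "finite (Range f) \<longleftrightarrow> finite (Domain f)"
proof -
  have "f `` Domain f = Range f" by blast
  then show ?thesis using chart_finite_Image_iff[OF assms order_refl] by simp
qed

text \<open>By injectivity the image of \<Gamma> has as many points as \<Gamma>, so for finite
  \<Gamma> one inclusion suffices.\<close>

lemma chart_Image_eqI:
  assumes f: "f \<in> sym_inv_monoid X" and "finite \<Gamma>" "\<Gamma> \<subseteq> Domain f" "\<Gamma> \<subseteq> f `` \<Gamma>"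
  shows "f `` \<Gamma> = \<Gamma>"
  using card_subset_eq[of "f `` \<Gamma>" \<Gamma>] chart_card_Image[OF f] chart_finite_Image[OF f] assms by simp

text \<open>The image of \<Gamma> ignores points outside the domain, but a finite set is never the
  injective image of a proper subset of itself.\<close>

lemma chart_stabilises_Domain:
  assumes f: "f \<in> sym_inv_monoid X" and fin: "finite \<Gamma>" and eq: "f `` \<Gamma> = \<Gamma>"
  shows "\<Gamma> \<subseteq> Domain f"
proof -
  have "f `` (\<Gamma> \<inter> Domain f) = \<Gamma>" using eq by blast
  then have "card \<Gamma> = card (\<Gamma> \<inter> Domain f)"
    using chart_card_Image[OF f, of "\<Gamma> \<inter> Domain f"] by simp
  then show ?thesis using card_subset_eq[OF fin, of "\<Gamma> \<inter> Domain f"] by auto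
qed

lemma chart_stabilises_converse:
  assumes f: "f \<in> sym_inv_monoid X" and fin: "finite \<Gamma>" and eq: "f `` \<Gamma> = \<Gamma>"
  shows "f\<inverse> `` \<Gamma> = \<Gamma>"
  using chart_stabilises_Domain[OF assms] eq chart_unique_left[OF f] by blast

lemma chart_of_bij_betw:
  assumes "bij_betw g A B" "A \<subseteq> X" "B \<subseteq> X"
  shows "{(x, g x) | x. x \<in> A} \<in> sym_inv_monoid X"
    "Domain {(x, g x) | x. x \<in> A} = A" "Range {(x, g x) | x. x \<in> A} = B"
  using assms by (auto simp: sym_inv_monoid_def bij_betw_def single_valued_def inj_on_def)

lemma chart_Un:
  assumes "f \<in> sym_inv_monoid X" "g \<in> sym_inv_monoid X"
    "Domain f \<inter> Domain g = {}" "Range f \<inter> Range g = {}"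
  shows "f \<union> g \<in> sym_inv_monoid X"
  using assms by (simp add: sym_inv_monoid_def single_valued_def) blast

lemma chart_Id_on: "A \<subseteq> X \<Longrightarrow> Id_on A \<in> sym_inv_monoid X"
  by (auto simp: sym_inv_monoid_def single_valued_def)

lemma chart_conjugate_total:
  assumes q: "q \<in> sym_inv_monoid X" and "Domain q = X" and h: "h \<in> sym_inv_monoid X"
  shows "q O (q\<inverse> O h O q) O q\<inverse> = h"
proof -
  have 1: "q O q\<inverse> = Id_on X"
  proof (intro equalityI subrelI)
    fix x z assume "(x, z) \<in> q O q\<inverse>"
    then obtain y where "(x, y) \<in> q" "(z, y) \<in> q" by blast
    then show "(x, z) \<in> Id_on X"
      using chart_unique_left[OF q] chart_in_carrier[OF q] by blast
  next
    fix x z assume "(x, z) \<in> Id_on X"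
    then show "(x, z) \<in> q O q\<inverse>" using assms(2) by blast
  qed
  have "Id_on X O h O Id_on X = h"
    using chart_in_carrier[OF h] by auto
  with 1 show ?thesis by (metis O_assoc)
qed

section \<open>Cardinals of a countably infinite set\<close>

lemma countable_ordIso_natLeq_iff:
  assumes "countable A" shows "|A| =o natLeq \<longleftrightarrow> infinite A"
proof
  show "infinite A" if "|A| =o natLeq"
    using that finite_iff_ordLess_natLeq not_ordLess_ordIso by blast
next
  assume "infinite A"
  then have "|A| =o |UNIV :: nat set|"
    using assms to_nat_on_infinite card_of_ordIso by blast
  then show "|A| =o natLeq"
    using card_of_nat ordIso_transitive by blast
qed

lemma P_semigroup_iff:
  assumes X: "countable X" "infinite X"
  shows "f \<in> P_semigroup X \<Gamma> \<longleftrightarrow> f \<in> sym_inv_monoid X \<and>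
    (\<not> \<Gamma> \<subseteq> Domain f \<and> \<not> \<Gamma> \<subseteq> Range f \<or> f `` \<Gamma> = \<Gamma> \<or> finite (Range f))"
proof -
  have "|X| =o natLeq" using countable_ordIso_natLeq_iff X countable_Diff by blast
  then have "|A| <o |X| \<longleftrightarrow> finite A" for A :: "'a set"
    by (meson finite_iff_ordLess_natLeq ordIso_symmetric ordLess_ordIso_trans)
  then show ?thesis by (auto simp: P_semigroup_def small_charts_def)
qed

text \<open>Expanding the conjunction of the two disjunctions gives clauses (a), (b), (c) and (e);
  the last disjunct is clause (d). In this form inversion merely exchanges the conditions on domain
  and image.\<close>

lemma Q_semigroup_iff:
  assumes X: "countable X"
  shows "f \<in> Q_semigroup X \<Gamma> \<longleftrightarrow> f \<in> sym_inv_monoid X \<and>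
    ((\<not> \<Gamma> \<subseteq> Domain f \<or> infinite (X - Domain f)) \<and> (\<not> \<Gamma> \<subseteq> Range f \<or> infinite (X - Range f)) \<or>
     f `` \<Gamma> = \<Gamma> \<and> finite (X - Domain f) \<and> finite (X - Range f))"
proof -
  have *: "|X - A| =o natLeq \<longleftrightarrow> infinite (X - A)" for A
    using countable_ordIso_natLeq_iff X countable_Diff by blast
  have **: "|A| +c |B| <o natLeq \<longleftrightarrow> finite A \<and> finite B" for A B :: "'a set"
    by (simp add: csum_def Field_card_of flip: finite_iff_ordLess_natLeq)
  show ?thesis
    unfolding Q_semigroup_def collapse_def defect_def mem_Collect_eq * ** by blast
qed

section \<open>Total charts and stabiliser elements with prescribed behaviour\<close>

lemma bij_betw_countably_infinite:
  assumes "countable A" "infinite A" "countable B" "infinite B"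
  shows "\<exists>g. bij_betw g A B"
  using assms by (meson bij_betw_from_nat_into bij_betw_trans to_nat_on_infinite)

text \<open>Precomposing a chart \<open>f\<close> with such a \<open>p\<close>, where
  \<open>Z\<close> lies in the domain of \<open>f\<close>, makes it total and keeps control of
  \<Gamma>.\<close>

lemma ex_total_chart_fixing:
  assumes X: "countable X" "infinite X" and Z: "Z \<subseteq> X" "infinite Z" and \<Gamma>: "\<Gamma> \<subseteq> Z" "finite \<Gamma>"
  shows "\<exists>p\<in>sym_inv_monoid X. Domain p = X \<and> Range p = Z \<and> p `` \<Gamma> = \<Gamma>"
proof -
  obtain g where g: "bij_betw g (X - \<Gamma>) (Z - \<Gamma>)"
    using bij_betw_countably_infinite[of "X - \<Gamma>" "Z - \<Gamma>"] assms
    by (meson countable_Diff countable_subset Diff_infinite_finite)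
  note c = chart_of_bij_betw[OF g, of X]
  let ?p = "Id_on \<Gamma> \<union> {(x, g x) | x. x \<in> X - \<Gamma>}"
  have "?p \<in> sym_inv_monoid X"
    using c Z \<Gamma> by (intro chart_Un chart_Id_on) (auto simp: Domain_Id_on)
  moreover have "Domain ?p = X" "Range ?p = Z"
    using c Z \<Gamma> by (auto simp: Domain_Un_eq Range_Un_eq)
  moreover have "?p `` \<Gamma> = \<Gamma>" by auto
  ultimately show ?thesis by blast
qed

text \<open>The two bijections are glued with the identity on \<Sigma>. The second one expresses
  that the complements of \<open>A\<close> and \<open>B\<close> outside \<Sigma> match as
  well.\<close>

lemma ex_stabiliser_moving:
  assumes "bij_betw g A B" "bij_betw h (X - \<Sigma> - A) (X - \<Sigma> - B)"
    and "A \<subseteq> X - \<Sigma>" "B \<subseteq> X - \<Sigma>" "\<Sigma> \<subseteq> X"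
  shows "\<exists>p\<in>pointwise_stabiliser X \<Sigma>. p `` A = B"
proof -
  have sub: "A \<subseteq> X" "B \<subseteq> X" "X - \<Sigma> - A \<subseteq> X" "X - \<Sigma> - B \<subseteq> X"
    using assms(3,4) by auto
  note g = chart_of_bij_betw[OF assms(1) sub(1,2)] and h = chart_of_bij_betw[OF assms(2) sub(3,4)]
  let ?g = "{(x, g x) | x. x \<in> A}" and ?h = "{(x, h x) | x. x \<in> X - \<Sigma> - A}"
  let ?p = "(?g \<union> ?h) \<union> Id_on \<Sigma>"
  have "?p \<in> sym_inv_monoid X"
    using assms(3-) unfolding Un_assoc
    by (intro chart_Un chart_Id_on g(1) h(1)) (simp_all only: Domain_Un_eq Range_Un_eq g h
        Domain_Id_on Range_Id_on, blast+)
  moreover have "Domain ?p = X" "Range ?p = X"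
    unfolding Domain_Un_eq Range_Un_eq g h Domain_Id_on Range_Id_on using assms(3-) by blast+
  moreover have "?p `` A = B"
    using assms by (auto simp: bij_betw_def)
  ultimately show ?thesis
    by (intro bexI[of _ ?p]) (auto simp: pointwise_stabiliser_def Sym_def)
qed

section \<open>Maximality\<close>

lemma total_conjugation_imp_full:
  assumes N: "inverse_subsemigroup X N" and q: "q \<in> N" "Domain q = X"
    and conj: "\<And>h. h \<in> sym_inv_monoid X \<Longrightarrow> q\<inverse> O h O q \<in> N"
  shows "N = sym_inv_monoid X"
proof -
  have "h \<in> N" if "h \<in> sym_inv_monoid X" for h
    using chart_conjugate_total[of q X h] that conj[OF that] N q
    unfolding inverse_subsemigroup_def by (metis subsetD)
  then show ?thesis using N by (auto simp: inverse_subsemigroup_def)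
qed

text \<open>If both factors miss points of \<Gamma> on both sides, the product inherits this from
  the domain of \<open>f\<close> and the image of \<open>g\<close>. If one factor stabilises
  \<Gamma>, it carries the missing points of the other one along (facts \<open>l\<close> and
  \<open>r\<close>).\<close>

lemma inverse_subsemigroup_P:
  assumes X: "countable X" "infinite X" and \<Gamma>: "finite \<Gamma>"
  shows "inverse_subsemigroup X (P_semigroup X \<Gamma>)"
  unfolding inverse_subsemigroup_def
proof (intro conjI ballI)
  show "P_semigroup X \<Gamma> \<subseteq> sym_inv_monoid X"
    using P_semigroup_iff[OF X] by blast
next
  fix f assume "f \<in> P_semigroup X \<Gamma>"
  then show "f\<inverse> \<in> P_semigroup X \<Gamma>"
    using chart_finite_Range_iff[of f X] chart_stabilises_converse[OF _ \<Gamma>, of f X] chart_converse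
    unfolding P_semigroup_iff[OF X] Domain_converse Range_converse by blast
next
  fix f g assume fg: "f \<in> P_semigroup X \<Gamma>" "g \<in> P_semigroup X \<Gamma>"
  then have f: "f \<in> sym_inv_monoid X" and g: "g \<in> sym_inv_monoid X"
    unfolding P_semigroup_iff[OF X] by auto
  have fin: "finite (Range (f O g))" if "finite (Range f) \<or> finite (Range g)"
  proof -
    have "Range (f O g) \<subseteq> g `` Range f" "Range (f O g) \<subseteq> Range g" by auto
    then show ?thesis using that chart_finite_Image[OF g] finite_subset by metis
  qed
  have l: "\<not> \<Gamma> \<subseteq> Domain (f O g)" if "f `` \<Gamma> = \<Gamma>" "\<not> \<Gamma> \<subseteq> Domain g"
  proof
    assume "\<Gamma> \<subseteq> Domain (f O g)"
    with that(1) chart_unique_right[OF f] have "\<Gamma> \<subseteq> Domain g" by blast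
    with that(2) show False ..
  qed
  have r: "\<not> \<Gamma> \<subseteq> Range (f O g)" if "g `` \<Gamma> = \<Gamma>" "\<not> \<Gamma> \<subseteq> Range f"
  proof
    assume "\<Gamma> \<subseteq> Range (f O g)"
    with chart_stabilises_converse[OF g \<Gamma> that(1)] chart_unique_left[OF g]
    have "\<Gamma> \<subseteq> Range f" by blast
    with that(2) show False ..
  qed
  have "\<not> \<Gamma> \<subseteq> Domain (f O g)" if "\<not> \<Gamma> \<subseteq> Domain f" using that by blast
  moreover have "\<not> \<Gamma> \<subseteq> Range (f O g)" if "\<not> \<Gamma> \<subseteq> Range g" using that by blast
  moreover have "(f O g) `` \<Gamma> = \<Gamma>" if "f `` \<Gamma> = \<Gamma>" "g `` \<Gamma> = \<Gamma>"
    using that by (simp add: relcomp_Image)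
  ultimately show "f O g \<in> P_semigroup X \<Gamma>"
    using fg fin l r chart_comp[OF f g] unfolding P_semigroup_iff[OF X] by blast
qed

lemma inverse_subsemigroup_Q:
  assumes X: "countable X" and \<Gamma>: "finite \<Gamma>"
  shows "inverse_subsemigroup X (Q_semigroup X \<Gamma>)"
proof -
  \<comment> \<open>\<open>A\<close> is the one-sided condition on the domain. With \<open>S\<close>
    for clause (d), \<open>Q_semigroup\<close> consists of the charts with \<open>A\<close> for both
    \<open>f\<close> and its inverse, or with \<open>S\<close>.\<close>
  define A where "A f \<longleftrightarrow> \<not> \<Gamma> \<subseteq> Domain f \<or> infinite (X - Domain f)" for f :: "'a rel"
  define S where "S f \<longleftrightarrow> f `` \<Gamma> = \<Gamma> \<and> finite (X - Domain f) \<and> finite (X - Range f)"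
    for f :: "'a rel"
  have iff: "f \<in> Q_semigroup X \<Gamma> \<longleftrightarrow> f \<in> sym_inv_monoid X \<and> (A f \<and> A (f\<inverse>) \<or> S f)" for f
    unfolding Q_semigroup_iff[OF X] A_def S_def by simp
  have S_conv: "S (f\<inverse>)" if "S f" "f \<in> sym_inv_monoid X" for f
    using that chart_stabilises_converse[OF _ \<Gamma>, of f X] by (auto simp: S_def)
  have A1: "A (f O g)" if "A f" for f g
  proof -
    have "Domain (f O g) \<subseteq> Domain f" by blast
    then show ?thesis using that unfolding A_def by (meson Diff_mono finite_subset order_refl order_trans)
  qed
  have A2: "A (f O g)" if f: "f \<in> sym_inv_monoid X" and g: "g \<in> sym_inv_monoid X"
    and "S f" "A g" for f g
  proof (cases "\<Gamma> \<subseteq> Domain g")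
    case False
    have "\<not> \<Gamma> \<subseteq> Domain (f O g)"
    proof
      assume "\<Gamma> \<subseteq> Domain (f O g)"
      with \<open>S f\<close> chart_unique_right[OF f] have "\<Gamma> \<subseteq> Domain g" unfolding S_def by blast
      with False show False ..
    qed
    then show ?thesis by (simp add: A_def)
  next
    case True
    \<comment> \<open>Here \<open>g\<close> has infinite collapse. All but finitely many points
      outside its domain are images under \<open>f\<close> of points where the product is undefined,
      so the product has infinite collapse too.\<close>
    have "X - Domain g \<subseteq> (X - Range f) \<union> f `` (X - Domain (f O g))"
    proof
      fix y assume y: "y \<in> X - Domain g"
      show "y \<in> (X - Range f) \<union> f `` (X - Domain (f O g))"
      proof (cases "y \<in> Range f")
        case True
        then obtain x where x: "(x, y) \<in> f" by blast
        with y have "x \<notin> Domain (f O g)" using chart_unique_right[OF f] by blast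
        with x show ?thesis using chart_in_carrier[OF f x] by blast
      qed (use y in blast)
    qed
    with True that show ?thesis
      unfolding A_def S_def by (meson chart_finite_Image[OF f] finite_UnI finite_subset)
  qed
  have SS: "S (f O g)" if f: "f \<in> sym_inv_monoid X" and g: "g \<in> sym_inv_monoid X"
    and "S f" "S g" for f g
  proof -
    have "X - Domain (f O g) \<subseteq> (X - Domain f) \<union> f\<inverse> `` (X - Domain g)"
      "X - Range (f O g) \<subseteq> (X - Range g) \<union> g `` (X - Range f)"
      using chart_in_carrier[OF f] chart_in_carrier[OF g] by blast+
    moreover have "(f O g) `` \<Gamma> = \<Gamma>" using \<open>S f\<close> \<open>S g\<close> by (simp add: relcomp_Image S_def)
    ultimately show ?thesis using \<open>S f\<close> \<open>S g\<close> unfolding S_def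
      by (meson chart_finite_Image[OF chart_converse[OF f]] chart_finite_Image[OF g]
          finite_UnI finite_subset)
  qed
  show ?thesis
    unfolding inverse_subsemigroup_def iff[abs_def] subset_eq
  proof (intro conjI ballI)
    fix f g assume fg: "f \<in> Q_semigroup X \<Gamma>" "g \<in> Q_semigroup X \<Gamma>"
    then have f: "f \<in> sym_inv_monoid X" and g: "g \<in> sym_inv_monoid X" by (auto simp: iff)
    show "f O g \<in> sym_inv_monoid X" using f g by (rule chart_comp)
    have "A (f O g)" if "A f \<and> A (f\<inverse>) \<or> A g \<and> A (g\<inverse>)"
      using that fg A1 A2[OF f g] by (auto simp: iff)
    moreover have "A ((f O g)\<inverse>)" if "A f \<and> A (f\<inverse>) \<or> A g \<and> A (g\<inverse>)"
      using that fg A1 A2[OF chart_converse[OF g] chart_converse[OF f]] S_conv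
      by (auto simp: iff converse_relcomp)
    ultimately show "A (f O g) \<and> A ((f O g)\<inverse>) \<or> S (f O g)"
      using fg SS[OF f g] by (auto simp: iff)
  qed (use iff chart_converse S_conv in auto)
qed

text \<open>\<open>C f\<close> says that the domain of \<open>f\<close> is large enough for
  \<open>f\<close> to be made total by precomposition within \<open>M\<close>. A chart outside
  \<open>M\<close> has this property or its inverse does, and passing to the inverse leaves neither
  \<open>N\<close> nor the complement of \<open>M\<close>.\<close>

lemma maximal_inverse_subsemigroupI:
  assumes M: "inverse_subsemigroup X M" "M \<noteq> sym_inv_monoid X"
    and full: "\<And>f N. \<lbrakk>inverse_subsemigroup X N; M \<subseteq> N; f \<in> N; f \<notin> M; C f\<rbrakk>
      \<Longrightarrow> N = sym_inv_monoid X"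
    and C: "\<And>f. \<lbrakk>f \<in> sym_inv_monoid X; \<not> C f; \<not> C (f\<inverse>)\<rbrakk> \<Longrightarrow> f \<in> M"
  shows "maximal_inverse_subsemigroup X M"
  unfolding maximal_inverse_subsemigroup_def
proof (intro conjI allI impI M)
  fix N assume N: "inverse_subsemigroup X N \<and> N \<noteq> sym_inv_monoid X \<and> M \<subseteq> N"
  show "N = M"
  proof (rule ccontr)
    assume "N \<noteq> M"
    with N obtain f where f: "f \<in> N" "f \<notin> M" by blast
    with N have "f \<in> sym_inv_monoid X" by (auto simp: inverse_subsemigroup_def)
    with f C have "C f \<or> C (f\<inverse>)" by blast
    moreover have "f\<inverse> \<in> N" "f\<inverse> \<notin> M"
      using f N M(1) unfolding inverse_subsemigroup_def by (auto dest: bspec[of M _ "f\<inverse>"])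
    ultimately show False using full f N by blast
  qed
qed

lemma ex_Sym_moving:
  assumes X: "countable X" "infinite X" and \<Gamma>: "\<Gamma> \<subseteq> X" "finite \<Gamma>" "\<Gamma> \<noteq> {}"
  shows "\<exists>p\<in>Sym X. p `` \<Gamma> \<noteq> \<Gamma>"
proof -
  obtain a where a: "a \<in> \<Gamma>" using \<Gamma>(3) by blast
  obtain b where b: "b \<in> X - \<Gamma>"
    using X(2) \<Gamma>(2) by (metis Diff_infinite_finite ex_in_conv finite.emptyI)
  have "bij_betw (\<lambda>_. b) {a} {b}" by (simp add: bij_betw_def)
  moreover obtain h where "bij_betw h (X - {} - {a}) (X - {} - {b})"
    using bij_betw_countably_infinite[of "X - {} - {a}" "X - {} - {b}"] X by auto
  \<comment> \<open>For empty \<Sigma> the pointwise stabiliser is the whole of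
    \<open>Sym X\<close>.\<close>
  ultimately obtain p where p: "p \<in> pointwise_stabiliser X {}" "p `` {a} = {b}"
    using ex_stabiliser_moving[of _ "{a}" "{b}" _ X "{}"] a b \<Gamma>(1) by blast
  have "b \<in> p `` \<Gamma>" using p(2) a by blast
  with p(1) b show ?thesis by (auto simp: pointwise_stabiliser_def)
qed

text \<open>A permutation is total and onto with infinite image, so stabilising \<Gamma> is the only
  clause it could satisfy.\<close>

lemma not_Sym_subset_P:
  assumes X: "countable X" "infinite X" and \<Gamma>: "\<Gamma> \<subseteq> X" "finite \<Gamma>" "\<Gamma> \<noteq> {}"
  shows "\<not> Sym X \<subseteq> P_semigroup X \<Gamma>"
proof
  assume sub: "Sym X \<subseteq> P_semigroup X \<Gamma>"
  obtain p where p: "p \<in> Sym X" "p `` \<Gamma> \<noteq> \<Gamma>" using ex_Sym_moving[OF assms] by blast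
  with sub have "p \<in> P_semigroup X \<Gamma>" by blast
  then show False
    using p X(2) \<Gamma>(1) unfolding P_semigroup_iff[OF X] Sym_def by simp
qed

lemma not_Sym_subset_Q:
  assumes X: "countable X" "infinite X" and \<Gamma>: "\<Gamma> \<subseteq> X" "finite \<Gamma>" "\<Gamma> \<noteq> {}"
  shows "\<not> Sym X \<subseteq> Q_semigroup X \<Gamma>"
proof
  assume sub: "Sym X \<subseteq> Q_semigroup X \<Gamma>"
  obtain p where p: "p \<in> Sym X" "p `` \<Gamma> \<noteq> \<Gamma>" using ex_Sym_moving[OF assms] by blast
  with sub have "p \<in> Q_semigroup X \<Gamma>" by blast
  then show False
    using p X(2) \<Gamma>(1) unfolding Q_semigroup_iff[OF X(1)] Sym_def by simp
qed

lemma Sym_subset_monoid: "Sym X \<subseteq> sym_inv_monoid X"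
  by (auto simp: Sym_def)

lemma maximal_P:
  assumes X: "countable X" "infinite X" and \<Gamma>: "\<Gamma> \<subseteq> X" "finite \<Gamma>" "\<Gamma> \<noteq> {}"
  shows "maximal_inverse_subsemigroup X (P_semigroup X \<Gamma>)"
proof (rule maximal_inverse_subsemigroupI[where C = "\<lambda>f. \<Gamma> \<subseteq> Domain f"])
  show "inverse_subsemigroup X (P_semigroup X \<Gamma>)"
    using inverse_subsemigroup_P X \<Gamma> by blast
  show "P_semigroup X \<Gamma> \<noteq> sym_inv_monoid X"
    using not_Sym_subset_P[OF assms] Sym_subset_monoid by metis
  show "f \<in> P_semigroup X \<Gamma>"
    if "f \<in> sym_inv_monoid X" "\<not> \<Gamma> \<subseteq> Domain f" "\<not> \<Gamma> \<subseteq> Domain (f\<inverse>)" for f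
    using that by (simp add: P_semigroup_iff[OF X])
next
  fix f N assume N: "inverse_subsemigroup X N" "P_semigroup X \<Gamma> \<subseteq> N"
    and fN: "f \<in> N" and "f \<notin> P_semigroup X \<Gamma>" and dom: "\<Gamma> \<subseteq> Domain f"
  then have f: "f \<in> sym_inv_monoid X" and neq: "f `` \<Gamma> \<noteq> \<Gamma>" and inf: "infinite (Domain f)"
    using chart_finite_Range_iff[of f X] by (auto simp: P_semigroup_iff[OF X] inverse_subsemigroup_def)
  obtain y where y: "y \<in> \<Gamma>" "y \<notin> f `` \<Gamma>"
    using chart_Image_eqI[OF f \<Gamma>(2) dom] neq by blast
  \<comment> \<open>Dropping the preimage of \<open>y\<close>, at most one point and not in
    \<Gamma>, makes the image of \<open>p O f\<close> miss \<open>y\<close>. All conjugates by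
    \<open>p O f\<close> then miss \<open>y\<close> in domain and image, which puts them into
    \<open>P_semigroup\<close>.\<close>
  let ?Z = "Domain f - f\<inverse> `` {y}"
  have Z: "?Z \<subseteq> X" "infinite ?Z" "\<Gamma> \<subseteq> ?Z"
    using chart_in_carrier[OF f] inf dom y chart_finite_Image[OF chart_converse[OF f], of "{y}"]
    by auto
  obtain p where p: "p \<in> sym_inv_monoid X" "Domain p = X" "Range p = ?Z" "p `` \<Gamma> = \<Gamma>"
    using ex_total_chart_fixing[OF X Z \<Gamma>(2)] by blast
  then have "p \<in> P_semigroup X \<Gamma>" by (simp add: P_semigroup_iff[OF X])
  then have "p \<in> N" using N(2) by blast
  then have "p O f \<in> N" using N(1) fN by (auto simp: inverse_subsemigroup_def)
  moreover have "Domain (p O f) = X" using p(2,3) by blast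
  moreover have "(p O f)\<inverse> O h O (p O f) \<in> N" if h: "h \<in> sym_inv_monoid X" for h
  proof -
    have "y \<notin> Range (p O f)" using p(3) by blast
    then have "y \<notin> Domain ((p O f)\<inverse> O h O (p O f))" "y \<notin> Range ((p O f)\<inverse> O h O (p O f))"
      by blast+
    moreover have "(p O f)\<inverse> O h O (p O f) \<in> sym_inv_monoid X"
      using p(1) f h by (intro chart_comp chart_converse)
    ultimately have "(p O f)\<inverse> O h O (p O f) \<in> P_semigroup X \<Gamma>"
      unfolding P_semigroup_iff[OF X] using y(1) by (meson subsetD)
    then show ?thesis using N(2) by blast
  qed
  ultimately show "N = sym_inv_monoid X" by (rule total_conjugation_imp_full[OF N(1)])
qed

lemma maximal_Q:
  assumes X: "countable X" "infinite X" and \<Gamma>: "\<Gamma> \<subseteq> X" "finite \<Gamma>" "\<Gamma> \<noteq> {}"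
  shows "maximal_inverse_subsemigroup X (Q_semigroup X \<Gamma>)"
proof (rule maximal_inverse_subsemigroupI[where C = "\<lambda>f. \<Gamma> \<subseteq> Domain f \<and> finite (X - Domain f)"])
  show "inverse_subsemigroup X (Q_semigroup X \<Gamma>)"
    using inverse_subsemigroup_Q X \<Gamma> by blast
  show "Q_semigroup X \<Gamma> \<noteq> sym_inv_monoid X"
    using not_Sym_subset_Q[OF assms] Sym_subset_monoid by metis
  show "f \<in> Q_semigroup X \<Gamma>"
    if "f \<in> sym_inv_monoid X" "\<not> (\<Gamma> \<subseteq> Domain f \<and> finite (X - Domain f))"
      "\<not> (\<Gamma> \<subseteq> Domain (f\<inverse>) \<and> finite (X - Domain (f\<inverse>)))" for f
    using that by (auto simp: Q_semigroup_iff[OF X(1)])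
next
  fix f N assume N: "inverse_subsemigroup X N" "Q_semigroup X \<Gamma> \<subseteq> N"
    and fN: "f \<in> N" and nQ: "f \<notin> Q_semigroup X \<Gamma>"
    and dom: "\<Gamma> \<subseteq> Domain f \<and> finite (X - Domain f)"
  then have f: "f \<in> sym_inv_monoid X"
    by (auto simp: inverse_subsemigroup_def)
  \<comment> \<open>Cofiniteness of \<open>Z\<close> puts \<open>p\<close> into
    \<open>Q_semigroup\<close> by clause (d), and conjugates by \<open>p O f\<close> have domain and
    image inside the image of \<open>Z\<close>. Below, \<open>Z\<close> is the whole domain if
    \<open>f\<close> has infinite defect, and otherwise the domain without the preimage of a point
    of \<Gamma>.\<close>
  have absorb: "N = sym_inv_monoid X"
    if Z: "Z \<subseteq> Domain f" "finite (X - Z)" "\<Gamma> \<subseteq> Z"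
      and R: "infinite (X - f `` Z) \<or> \<not> \<Gamma> \<subseteq> f `` Z" for Z
  proof -
    have "Z \<subseteq> X" "infinite Z"
      using Z chart_in_carrier[OF f] X(2) by (auto dest: finite_subset[of X "Z \<union> (X - Z)"])
    then obtain p where p: "p \<in> sym_inv_monoid X" "Domain p = X" "Range p = Z" "p `` \<Gamma> = \<Gamma>"
      using ex_total_chart_fixing[OF X _ _ _ \<Gamma>(2)] Z(3) by blast
    then have "p \<in> Q_semigroup X \<Gamma>" using Z(2) by (simp add: Q_semigroup_iff[OF X(1)])
    then have "p \<in> N" using N(2) by blast
    then have "p O f \<in> N" using N(1) fN by (auto simp: inverse_subsemigroup_def)
    moreover have "Domain (p O f) = X" using p(2,3) Z(1) by blast
    moreover have "(p O f)\<inverse> O h O (p O f) \<in> N" if h: "h \<in> sym_inv_monoid X" for h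
    proof -
      let ?k = "(p O f)\<inverse> O h O (p O f)"
      have sub: "Domain ?k \<subseteq> f `` Z" "Range ?k \<subseteq> f `` Z" using p(3) by blast+
      have "?k \<in> sym_inv_monoid X"
        using p(1) f h by (intro chart_comp chart_converse)
      moreover have "(\<not> \<Gamma> \<subseteq> Domain ?k \<or> infinite (X - Domain ?k)) \<and>
          (\<not> \<Gamma> \<subseteq> Range ?k \<or> infinite (X - Range ?k))"
        using R
      proof
        assume "infinite (X - f `` Z)"
        then show ?thesis using sub by (meson Diff_mono finite_subset order_refl)
      next
        assume "\<not> \<Gamma> \<subseteq> f `` Z"
        then show ?thesis using sub by (meson order_trans)
      qed
      ultimately have "?k \<in> Q_semigroup X \<Gamma>" unfolding Q_semigroup_iff[OF X(1)] by simp
      then show ?thesis using N(2) by blast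
    qed
    ultimately show ?thesis by (rule total_conjugation_imp_full[OF N(1)])
  qed
  show "N = sym_inv_monoid X"
  proof (cases "finite (X - Range f)")
    case False
    moreover have "f `` Domain f = Range f" by blast
    ultimately show ?thesis using absorb[of "Domain f"] dom by simp
  next
    case True
    with nQ f dom have "f `` \<Gamma> \<noteq> \<Gamma>" by (auto simp: Q_semigroup_iff[OF X(1)])
    then obtain y where y: "y \<in> \<Gamma>" "y \<notin> f `` \<Gamma>"
      using chart_Image_eqI[OF f \<Gamma>(2)] dom by blast
    let ?Z = "Domain f - f\<inverse> `` {y}"
    have "X - ?Z \<subseteq> (X - Domain f) \<union> f\<inverse> `` {y}" by blast
    then have "finite (X - ?Z)"
      using dom chart_finite_Image[OF chart_converse[OF f], of "{y}"] by (simp add: finite_subset)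
    moreover have "y \<notin> f `` ?Z" "\<Gamma> \<subseteq> ?Z" using y dom by blast+
    ultimately show ?thesis using absorb[of ?Z] y(1) by blast
  qed
qed

section \<open>Semigroups containing a pointwise stabiliser\<close>

text \<open>This makes the minimal set \<Gamma> found below non-empty. The conjugate of a
  permutation by \<open>q\<close> permutes the image of \<open>q\<close>, and \<Sigma> lies in the
  complement, where the extension is the identity.\<close>

lemma Sym_subset_if_total_avoiding:
  assumes M: "inverse_subsemigroup X M" "pointwise_stabiliser X \<Sigma> \<subseteq> M"
    and q: "q \<in> M" "Domain q = X" "Range q \<inter> \<Sigma> = {}" and \<Sigma>: "\<Sigma> \<subseteq> X"
  shows "Sym X \<subseteq> M"
proof
  fix h assume "h \<in> Sym X"
  then have h: "h \<in> sym_inv_monoid X" "Domain h = X" "Range h = X" by (auto simp: Sym_def)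
  have qc: "q \<in> sym_inv_monoid X" using M(1) q(1) by (auto simp: inverse_subsemigroup_def)
  let ?k = "q\<inverse> O h O q" and ?i = "Id_on (X - Range q)"
  have dom: "Domain ?k = Range q"
  proof -
    have "y \<in> Domain ?k" if "(x, y) \<in> q" for x y
      using that chart_in_carrier[OF qc that] h(2) q(2) chart_in_carrier[OF h(1)] by blast
    then show ?thesis by blast
  qed
  have ran: "Range ?k = Range q"
  proof -
    have "y \<in> Range ?k" if "(x, y) \<in> q" for x y
      using that chart_in_carrier[OF qc that] h(3) q(2) chart_in_carrier[OF h(1)] by blast
    then show ?thesis by blast
  qed
  have "?k \<union> ?i \<in> sym_inv_monoid X"
    using dom ran qc h(1) by (intro chart_Un chart_Id_on chart_comp chart_converse) auto
  moreover have "Domain (?k \<union> ?i) = X" "Range (?k \<union> ?i) = X"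
    using dom ran chart_in_carrier[OF qc] by (auto simp: Domain_Un_eq Range_Un_eq)
  ultimately have "?k \<union> ?i \<in> pointwise_stabiliser X \<Sigma>"
    using q(3) \<Sigma> unfolding pointwise_stabiliser_def Sym_def by blast
  then have "q O (?k \<union> ?i) O q\<inverse> \<in> M"
    using M q(1) unfolding inverse_subsemigroup_def by blast
  \<comment> \<open>The added identity lives off the image of \<open>q\<close>, so it disappears
    when conjugating back.\<close>
  moreover have "q O (?k \<union> ?i) O q\<inverse> = q O ?k O q\<inverse>" by auto
  ultimately show "h \<in> M" using chart_conjugate_total[OF qc q(2) h(1)] by simp
qed

text \<open>Multiplying by a stabiliser element on the right relocates missed points outside
  \<Sigma> while keeping the domain and the trace of the image on \<Sigma>.\<close>

lemma comp_stabiliser: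
  assumes w: "w \<in> sym_inv_monoid X" and p: "p \<in> pointwise_stabiliser X \<Sigma>"
  shows "Domain (w O p) = Domain w" "Range (w O p) \<inter> \<Sigma> = Range w \<inter> \<Sigma>"
    "Range w \<inter> A = {} \<Longrightarrow> Range (w O p) \<inter> p `` A = {}"
proof -
  have pc: "p \<in> sym_inv_monoid X" "Domain p = X" "\<And>y. y \<in> \<Sigma> \<Longrightarrow> (y, y) \<in> p"
    using p by (auto simp: pointwise_stabiliser_def Sym_def)
  show "Domain (w O p) = Domain w"
    using chart_in_carrier[OF w] pc(2) by blast
  show "Range (w O p) \<inter> \<Sigma> = Range w \<inter> \<Sigma>"
    using pc(3) chart_unique_left[OF pc(1)] by blast
  show "Range (w O p) \<inter> p `` A = {}" if "Range w \<inter> A = {}"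
    using that chart_unique_left[OF pc(1)] by blast
qed

text \<open>Used twice: for all total charts of \<open>M\<close> missing a point outside \<Sigma>,
  and for the total ones of infinite defect. A chart \<open>v\<close> whose image has the smallest
  trace on \<Sigma> turns out to permute that trace.\<close>

lemma ex_minimal_in_left_ideal:
  assumes X: "countable X" "infinite X" and \<Sigma>: "\<Sigma> \<subseteq> X" "finite \<Sigma>"
    and M: "inverse_subsemigroup X M" "pointwise_stabiliser X \<Sigma> \<subseteq> M"
    and V: "V \<subseteq> {v \<in> M. Domain v = X \<and> \<not> X - Range v \<subseteq> \<Sigma>}" "V \<noteq> {}"
    and ideal: "\<And>r v. \<lbrakk>r \<in> M; Domain r = X; v \<in> V\<rbrakk> \<Longrightarrow> r O v \<in> V"
  shows "\<exists>v\<in>V. \<forall>r\<in>M. Domain r = X \<longrightarrow> Range v \<inter> \<Sigma> \<subseteq> Range r"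
proof -
  obtain v where v: "v \<in> V"
    and min: "\<And>w. w \<in> V \<Longrightarrow> card (Range v \<inter> \<Sigma>) \<le> card (Range w \<inter> \<Sigma>)"
    using V(2) ex_has_least_nat[of "\<lambda>v. v \<in> V" _ "\<lambda>v. card (Range v \<inter> \<Sigma>)"] by blast
  have vM: "v \<in> M" "Domain v = X" "\<not> X - Range v \<subseteq> \<Sigma>" using v V(1) by auto
  then have vc: "v \<in> sym_inv_monoid X" using M(1) by (auto simp: inverse_subsemigroup_def)
  let ?\<Gamma> = "Range v \<inter> \<Sigma>"
  have fin: "finite ?\<Gamma>" using \<Sigma>(2) by simp
  \<comment> \<open>By minimality \<open>r O v\<close> has the same trace as \<open>v\<close>, so
    \<open>r\<close> must reach every preimage under \<open>v\<close> of a point of the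
    trace.\<close>
  have pre: "x \<in> Range r" if r: "r \<in> M" "Domain r = X" and "y \<in> ?\<Gamma>" "(x, y) \<in> v" for r x y
  proof -
    have "Range (r O v) \<inter> \<Sigma> \<subseteq> ?\<Gamma>" by blast
    then have "Range (r O v) \<inter> \<Sigma> = ?\<Gamma>"
      using card_seteq[OF fin] min[OF ideal[OF r v]] by blast
    with that(3) have "y \<in> Range (r O v)" by blast
    with that(4) show ?thesis using chart_unique_left[OF vc] by blast
  qed
  \<comment> \<open>Taking \<open>v\<close> itself for \<open>r\<close> shows that \<open>x\<close>
    is in its image, so \<open>x\<close> lies outside \<Sigma> if it is not in the trace. A
    stabiliser element then moves a missed point \<open>z\<close> to \<open>x\<close>, and
    \<open>v O p\<close> is a total chart in \<open>M\<close> missing \<open>x\<close>, against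
    \<open>pre\<close>.\<close>
  have "x \<in> ?\<Gamma>" if xy: "y \<in> ?\<Gamma>" "(x, y) \<in> v" for x y
  proof (rule ccontr)
    assume "x \<notin> ?\<Gamma>"
    with pre[OF vM(1,2) xy] have x: "x \<in> X - \<Sigma>" using chart_in_carrier[OF vc] by blast
    obtain z where z: "z \<in> X - \<Sigma>" "z \<notin> Range v" using vM(3) by blast
    have "bij_betw (\<lambda>_. x) {z} {x}" by (simp add: bij_betw_def)
    moreover obtain h where "bij_betw h (X - \<Sigma> - {z}) (X - \<Sigma> - {x})"
      using bij_betw_countably_infinite[of "X - \<Sigma> - {z}" "X - \<Sigma> - {x}"] X \<Sigma> by auto
    ultimately obtain p where p: "p \<in> pointwise_stabiliser X \<Sigma>" "p `` {z} = {x}"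
      using ex_stabiliser_moving[of _ "{z}" "{x}" _ X \<Sigma>] x z(1) \<Sigma>(1) by blast
    have "v O p \<in> M" using M p(1) vM(1) unfolding inverse_subsemigroup_def by blast
    moreover have "Domain (v O p) = X"
      using comp_stabiliser(1)[OF vc p(1)] vM(2) by simp
    moreover have "x \<notin> Range (v O p)"
      using comp_stabiliser(3)[OF vc p(1), of "{z}"] z(2) p(2) by auto
    ultimately show False using pre xy by blast
  qed
  then have "v\<inverse> `` ?\<Gamma> \<subseteq> ?\<Gamma>" by blast
  moreover have "card (v\<inverse> `` ?\<Gamma>) = card ?\<Gamma>"
    by (rule chart_card_Image[OF chart_converse[OF vc]]) auto
  ultimately have "v\<inverse> `` ?\<Gamma> = ?\<Gamma>" using card_subset_eq[OF fin] by blast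
  then have stab: "v `` ?\<Gamma> = ?\<Gamma>"
    using chart_stabilises_converse[OF chart_converse[OF vc] fin] by simp
  have "?\<Gamma> \<subseteq> Range r" if r: "r \<in> M" "Domain r = X" for r
  proof
    fix x assume x: "x \<in> ?\<Gamma>"
    with vM(2) chart_in_carrier[OF vc] obtain y where "(x, y) \<in> v" by blast
    moreover from this x stab have "y \<in> ?\<Gamma>" by blast
    ultimately show "x \<in> Range r" using pre[OF r] by blast
  qed
  with v show ?thesis by blast
qed

text \<open>The avoided set has two parts. Missing the points outside the domain of \<open>f\<close>
  makes \<open>w O f\<close> total; missing those that \<open>f\<close> sends into \<Sigma> from
  outside \<Sigma> forces every point of \<Gamma> to come from \<Gamma>.\<close>

lemma total_comp_imp_stabilises:
  assumes M: "inverse_subsemigroup X M" and w: "w \<in> M" "Domain w = X" "Range w \<inter> \<Sigma> = \<Gamma>"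
    and f: "f \<in> M" "\<Gamma> \<subseteq> Domain f" and avoid: "Range w \<inter> ((X - Domain f) \<union> f\<inverse> `` \<Sigma> - \<Sigma>) = {}"
    and sub: "\<forall>r\<in>M. Domain r = X \<longrightarrow> \<Gamma> \<subseteq> Range r" and fin: "finite \<Gamma>"
  shows "Domain (w O f) = X" "f `` \<Gamma> = \<Gamma>"
proof -
  have c: "w \<in> sym_inv_monoid X" "f \<in> sym_inv_monoid X"
    using M w(1) f(1) by (auto simp: inverse_subsemigroup_def)
  have "Range w \<subseteq> Domain f"
    using avoid f(2) w(3) chart_in_carrier[OF c(1)] by blast
  then show dom: "Domain (w O f) = X" using w(2) by blast
  have "w O f \<in> M" using M w(1) f(1) by (auto simp: inverse_subsemigroup_def)
  then have "\<Gamma> \<subseteq> Range (w O f)" using sub dom by blast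
  then have "\<Gamma> \<subseteq> f `` \<Gamma>" using avoid w(3) by blast
  then show "f `` \<Gamma> = \<Gamma>" using chart_Image_eqI[OF c(2) fin f(2)] by blast
qed

text \<open>Each further factor \<open>v\<close> carries the missed points along injectively and
  adds one outside its own image.\<close>

lemma ex_total_defect_ge:
  assumes M: "inverse_subsemigroup X M" and v: "v \<in> M" "Domain v = X" "Range v \<noteq> X"
  shows "\<exists>w\<in>M. Domain w = X \<and> (\<exists>A\<subseteq>X - Range w. finite A \<and> card A = n)"
proof (induction n)
  case 0
  show ?case using v by (intro bexI[of _ v] conjI exI[of _ "{}"]) auto
next
  case (Suc n)
  then obtain w A where w: "w \<in> M" "Domain w = X" "A \<subseteq> X - Range w" "finite A" "card A = n"
    by blast
  have c: "v \<in> sym_inv_monoid X" "w \<in> sym_inv_monoid X"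
    using M v(1) w(1) by (auto simp: inverse_subsemigroup_def)
  obtain x where x: "x \<in> X" "x \<notin> Range v"
    using v(3) chart_in_carrier[OF c(1)] by blast
  have "w O v \<in> M" using M v(1) w(1) by (auto simp: inverse_subsemigroup_def)
  moreover have "Domain (w O v) = X"
    using w(2) v(2) chart_in_carrier[OF c(2)] by blast
  moreover have "insert x (v `` A) \<subseteq> X - Range (w O v)"
    using x w(3) chart_in_carrier[OF c(1)] chart_unique_left[OF c(1)] by blast
  moreover have "A \<subseteq> Domain v" using w(3) v(2) by blast
  then have "finite (insert x (v `` A))" "card (insert x (v `` A)) = Suc n"
    using w(4,5) x(2) chart_finite_Image[OF c(1)] chart_card_Image[OF c(1)]
    by (auto simp: card_insert_if)
  ultimately show ?case by blast
qed

lemma ex_total_infinite_defect: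
  assumes X: "countable X" "infinite X" and \<Sigma>: "\<Sigma> \<subseteq> X" "finite \<Sigma>"
    and M: "inverse_subsemigroup X M" "pointwise_stabiliser X \<Sigma> \<subseteq> M" "\<not> Sym X \<subseteq> M"
    and v: "v \<in> M" "Domain v = X" "Range v \<noteq> X"
    and nQ: "\<And>\<Gamma>. \<lbrakk>\<Gamma> \<noteq> {}; \<Gamma> \<subseteq> \<Sigma>\<rbrakk> \<Longrightarrow> \<not> M \<subseteq> Q_semigroup X \<Gamma>"
  shows "\<exists>q\<in>M. Domain q = X \<and> infinite (X - Range q)"
proof -
  define V where "V = {v \<in> M. Domain v = X \<and> \<not> X - Range v \<subseteq> \<Sigma>}"
  have chart: "f \<in> sym_inv_monoid X" if "f \<in> M" for f
    using M(1) that by (auto simp: inverse_subsemigroup_def)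
  have comp: "f O g \<in> M" if "f \<in> M" "g \<in> M" for f g
    using M(1) that by (auto simp: inverse_subsemigroup_def)
  have total: "Domain (f O g) = X" if "f \<in> M" "Domain f = X" "Domain g = X" for f g :: "'a rel"
    using that chart_in_carrier[OF chart[OF that(1)]] by blast
  \<comment> \<open>One missed point more than \<Sigma> has elements guarantees a missed point
    outside \<Sigma>.\<close>
  obtain w A where w: "w \<in> M" "Domain w = X" "A \<subseteq> X - Range w" "finite A" "card A = Suc (card \<Sigma>)"
    using ex_total_defect_ge[OF M(1) v] by blast
  have "\<not> A \<subseteq> \<Sigma>" using card_mono[OF \<Sigma>(2), of A] w(5) by auto
  then have "w \<in> V" using w unfolding V_def by blast
  then have "V \<noteq> {}" by blast
  moreover have "r O u \<in> V" if "r \<in> M" "Domain r = X" "u \<in> V" for r u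
    using that comp[of r u] total[of r u] unfolding V_def by blast
  ultimately have "\<exists>v\<in>V. \<forall>r\<in>M. Domain r = X \<longrightarrow> Range v \<inter> \<Sigma> \<subseteq> Range r"
    by (rule ex_minimal_in_left_ideal[OF X \<Sigma> M(1,2) equalityD1[OF V_def]])
  then obtain u where u: "u \<in> V"
    and min': "\<forall>r\<in>M. Domain r = X \<longrightarrow> Range u \<inter> \<Sigma> \<subseteq> Range r" by (rule bexE)
  have min: "Range u \<inter> \<Sigma> \<subseteq> Range r" if "r \<in> M" "Domain r = X" for r
    using min' that by simp
  define \<Gamma> where "\<Gamma> = Range u \<inter> \<Sigma>"
  have uM: "u \<in> M" "Domain u = X" using u(1) by (auto simp: V_def)
  have \<Gamma>: "\<Gamma> \<subseteq> \<Sigma>" "finite \<Gamma>" using \<Sigma>(2) by (auto simp: \<Gamma>_def)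
  have "\<Gamma> \<noteq> {}"
    using Sym_subset_if_total_avoiding[OF M(1,2) uM] M(3) \<Sigma>(1) by (auto simp: \<Gamma>_def)
  then obtain f0 where f0: "f0 \<in> M" "f0 \<notin> Q_semigroup X \<Gamma>" using nQ \<Gamma>(1) by blast
  \<comment> \<open>Since \<open>f0\<close> is outside \<open>Q_semigroup\<close>, it or its inverse
    has finite collapse and \<Gamma> in its domain.\<close>
  define f where "f = (if \<Gamma> \<subseteq> Domain f0 \<and> finite (X - Domain f0) then f0 else f0\<inverse>)"
  have f: "f \<in> M" "\<Gamma> \<subseteq> Domain f" "finite (X - Domain f)" "f `` \<Gamma> \<noteq> \<Gamma> \<or> infinite (X - Range f)"
    using f0 M(1) chart[OF f0(1)] chart_stabilises_converse[OF chart_converse[OF chart[OF f0(1)]] \<Gamma>(2)]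
    by (auto simp: f_def Q_semigroup_iff[OF X(1)] inverse_subsemigroup_def)
  define K where "K = (X - Domain f) \<union> f\<inverse> `` \<Sigma> - \<Sigma>"
  have K: "finite K" "K \<subseteq> X - \<Sigma>"
    using f(3) chart_finite_Image[OF chart_converse[OF chart[OF f(1)]] \<Sigma>(2)]
      chart_in_carrier[OF chart[OF f(1)]] by (auto simp: K_def)
  \<comment> \<open>Enough missed points that at least \<open>card K\<close> of their images under
    \<open>u\<close> lie outside \<Sigma>; these are moved onto \<open>K\<close>. The last factor
    \<open>u\<close> keeps the trace inside \<Gamma>, and \<open>min\<close> gives equality.\<close>
  obtain w A where w: "w \<in> M" "Domain w = X" "A \<subseteq> X - Range w" "finite A"
    "card A = card K + card \<Sigma>"
    using ex_total_defect_ge[OF M(1) v, of "card K + card \<Sigma>"] by blast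
  let ?w = "w O u"
  have wM: "?w \<in> M" "Domain ?w = X" using comp total w uM by auto
  have "Range ?w \<inter> \<Sigma> = \<Gamma>"
    using min[OF wM] by (auto simp: \<Gamma>_def)
  have Au: "A \<subseteq> Domain u" using w(3) uM(2) by blast
  have "card K \<le> card (u `` A - \<Sigma>)"
    using diff_card_le_card_Diff[OF \<Sigma>(2), of "u `` A"] w(5)
      chart_card_Image[OF chart[OF uM(1)] Au] by simp
  then obtain B where B: "B \<subseteq> u `` A - \<Sigma>" "card B = card K" "finite B"
    by (meson obtain_subset_with_card_n)
  have B': "Range ?w \<inter> B = {}" "B \<subseteq> X - \<Sigma>"
    using B(1) w(3) chart_unique_left[OF chart[OF uM(1)]] chart_in_carrier[OF chart[OF uM(1)]]
    by blast+
  obtain g where g: "bij_betw g B K" using finite_same_card_bij[OF B(3) K(1) B(2)] by blast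
  obtain h where h: "bij_betw h (X - \<Sigma> - B) (X - \<Sigma> - K)"
    using bij_betw_countably_infinite[of "X - \<Sigma> - B" "X - \<Sigma> - K"] X \<Sigma> B(3) K(1)
    by (meson Diff_infinite_finite countable_Diff)
  obtain p where p: "p \<in> pointwise_stabiliser X \<Sigma>" "p `` B = K"
    using ex_stabiliser_moving[OF g h B'(2) K(2) \<Sigma>(1)] by blast
  let ?t = "?w O p"
  have t: "?t \<in> M" "Domain ?t = X" "Range ?t \<inter> \<Sigma> = \<Gamma>"
    using comp_stabiliser(1,2)[OF chart[OF wM(1)] p(1)] wM p(1) M(2) comp
      \<open>Range ?w \<inter> \<Sigma> = \<Gamma>\<close> by auto
  have avoid: "Range ?t \<inter> K = {}"
    using comp_stabiliser(3)[OF chart[OF wM(1)] p(1) B'(1)] p(2) by simp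
  note tf = total_comp_imp_stabilises[OF M(1) t f(1,2) avoid[unfolded K_def] min'[folded \<Gamma>_def] \<Gamma>(2)]
  \<comment> \<open>As \<open>f\<close> stabilises \<Gamma>, the choice of \<open>f\<close> leaves
    only infinite defect, which the total chart \<open>?t O f\<close> inherits.\<close>
  have "infinite (X - Range f)" using tf(2) f(4) by blast
  moreover have "X - Range f \<subseteq> X - Range (?t O f)" by blast
  ultimately have "infinite (X - Range (?t O f))" by (rule infinite_super[rotated])
  then show ?thesis using tf(1) comp[OF t(1) f(1)] by blast
qed

lemma total_infinite_defect_imp_subset_P:
  assumes X: "countable X" "infinite X" and \<Sigma>: "\<Sigma> \<subseteq> X" "finite \<Sigma>"
    and M: "inverse_subsemigroup X M" "pointwise_stabiliser X \<Sigma> \<subseteq> M" "\<not> Sym X \<subseteq> M"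
    and q: "q \<in> M" "Domain q = X" "infinite (X - Range q)"
  shows "\<exists>\<Gamma>. \<Gamma> \<noteq> {} \<and> \<Gamma> \<subseteq> \<Sigma> \<and> M \<subseteq> P_semigroup X \<Gamma>"
proof -
  define V where "V = {v \<in> M. Domain v = X \<and> infinite (X - Range v)}"
  have chart: "f \<in> sym_inv_monoid X" if "f \<in> M" for f
    using M(1) that by (auto simp: inverse_subsemigroup_def)
  have comp: "f O g \<in> M" if "f \<in> M" "g \<in> M" for f g
    using M(1) that by (auto simp: inverse_subsemigroup_def)
  have "V \<subseteq> {v \<in> M. Domain v = X \<and> \<not> X - Range v \<subseteq> \<Sigma>}"
    using \<Sigma>(2) finite_subset unfolding V_def by blast
  moreover have "V \<noteq> {}" using q by (auto simp: V_def)
  moreover have "r O v \<in> V" if "r \<in> M" "Domain r = X" "v \<in> V" for r v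
  proof -
    have "X - Range v \<subseteq> X - Range (r O v)" by blast
    moreover have "infinite (X - Range v)" using that(3) by (simp add: V_def)
    ultimately have "infinite (X - Range (r O v))" by (rule infinite_super)
    moreover have "Domain (r O v) = X"
      using that chart_in_carrier[OF chart[OF that(1)]] unfolding V_def by blast
    ultimately show ?thesis using that comp[of r v] by (simp add: V_def)
  qed
  ultimately have "\<exists>v\<in>V. \<forall>r\<in>M. Domain r = X \<longrightarrow> Range v \<inter> \<Sigma> \<subseteq> Range r"
    by (rule ex_minimal_in_left_ideal[OF X \<Sigma> M(1,2)])
  then obtain v where v: "v \<in> V"
    and min': "\<forall>r\<in>M. Domain r = X \<longrightarrow> Range v \<inter> \<Sigma> \<subseteq> Range r" by (rule bexE)
  define \<Gamma> where "\<Gamma> = Range v \<inter> \<Sigma>"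
  have vM: "v \<in> M" "Domain v = X" "infinite (X - Range v)" using v by (auto simp: V_def)
  have \<Gamma>: "\<Gamma> \<subseteq> \<Sigma>" "finite \<Gamma>" using \<Sigma>(2) by (auto simp: \<Gamma>_def)
  have "\<Gamma> \<noteq> {}"
    using Sym_subset_if_total_avoiding[OF M(1,2) vM(1,2)] M(3) \<Sigma>(1) by (auto simp: \<Gamma>_def)
  have stab: "f `` \<Gamma> = \<Gamma>" if f: "f \<in> M" "\<Gamma> \<subseteq> Domain f" "infinite (Domain f)" for f
  proof -
    \<comment> \<open>Infinite defect allows an infinite set to be avoided, so no bound on the
      collapse of \<open>f\<close> is required: all missed points outside \<Sigma> are moved onto a
      set \<open>B'\<close> containing the set to be avoided.\<close>
    define A where "A = X - Range v - \<Sigma>"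
    have "infinite (Domain f - (f\<inverse> `` \<Sigma> \<union> \<Sigma>))"
      using f(3) chart_finite_Image[OF chart_converse[OF chart[OF f(1)]] \<Sigma>(2)] \<Sigma>(2)
      by (simp add: Diff_infinite_finite)
    \<comment> \<open>\<open>C\<close> keeps the complement of \<open>B'\<close> infinite and
      \<open>B\<close> keeps \<open>B'\<close> infinite, so that both bijections for
      \<open>ex_stabiliser_moving\<close> exist.\<close>
    then obtain B C where BC: "B \<subseteq> Domain f - (f\<inverse> `` \<Sigma> \<union> \<Sigma>)" "C \<subseteq> Domain f - (f\<inverse> `` \<Sigma> \<union> \<Sigma>)"
      "infinite B" "infinite C" "B \<inter> C = {}"
      by (rule infinite_split)
    define B' where "B' = X - \<Sigma> - C"
    have K: "(X - Domain f) \<union> f\<inverse> `` \<Sigma> - \<Sigma> \<subseteq> B'"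
      using BC(2) chart_in_carrier[OF chart[OF f(1)]] unfolding B'_def by blast
    have "B \<subseteq> B'" 
      using BC(1,5) chart_in_carrier[OF chart[OF f(1)]] unfolding B'_def by blast
    moreover have "X - \<Sigma> - B' = C"
      using BC(2) chart_in_carrier[OF chart[OF f(1)]] unfolding B'_def by blast
    ultimately have inf: "infinite B'" "infinite (X - \<Sigma> - B')"
      using BC(3,4) finite_subset by auto
    have "infinite (Range v)"
      using chart_finite_Range_iff[OF chart[OF vM(1)]] vM(2) X(2) by simp
    moreover have "X - \<Sigma> - A = Range v - \<Sigma>"
      using chart_in_carrier[OF chart[OF vM(1)]] unfolding A_def by blast
    ultimately have inf': "infinite A" "infinite (X - \<Sigma> - A)"
      using \<Sigma>(2) vM(3) by (auto simp: A_def Diff_infinite_finite)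
    obtain g where g: "bij_betw g A B'"
      using bij_betw_countably_infinite[of A B'] inf inf' X(1)
      unfolding A_def B'_def by (meson countable_Diff)
    obtain h where h: "bij_betw h (X - \<Sigma> - A) (X - \<Sigma> - B')"
      using bij_betw_countably_infinite[of "X - \<Sigma> - A" "X - \<Sigma> - B'"] inf inf' X(1)
      by (meson countable_Diff)
    have "A \<subseteq> X - \<Sigma>" "B' \<subseteq> X - \<Sigma>" by (auto simp: A_def B'_def)
    then obtain p where p: "p \<in> pointwise_stabiliser X \<Sigma>" "p `` A = B'"
      using ex_stabiliser_moving[OF g h _ _ \<Sigma>(1)] by blast
    let ?w = "v O p"
    have "Range ?w \<inter> B' = {}"
      using comp_stabiliser(3)[OF chart[OF vM(1)] p(1), of A] p(2) by (auto simp: A_def)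
    with K have avoid: "Range ?w \<inter> ((X - Domain f) \<union> f\<inverse> `` \<Sigma> - \<Sigma>) = {}" by blast
    have w: "?w \<in> M" "Domain ?w = X" "Range ?w \<inter> \<Sigma> = \<Gamma>"
      using comp_stabiliser[OF chart[OF vM(1)] p(1)] vM(1,2) p(1) M(2) comp
      by (auto simp: \<Gamma>_def)
    show ?thesis
      by (rule total_comp_imp_stabilises(2)[OF M(1) w f(1,2) avoid min'[folded \<Gamma>_def] \<Gamma>(2)])
  qed
  have "f \<in> P_semigroup X \<Gamma>" if f: "f \<in> M" for f
  proof -
    have f': "f\<inverse> \<in> M" using f M(1) by (auto simp: inverse_subsemigroup_def)
    \<comment> \<open>Applying \<open>stab\<close> to the inverse covers the case of \<Gamma> inside
      the image.\<close>
    have "f `` \<Gamma> = \<Gamma>" if "\<Gamma> \<subseteq> Range f" "infinite (Range f)"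
      using stab[OF f'] that chart_stabilises_converse[OF chart[OF f'] \<Gamma>(2)] by simp
    then show ?thesis
      using stab[OF f] chart_finite_Range_iff[OF chart[OF f]] chart[OF f]
      unfolding P_semigroup_iff[OF X] by blast
  qed
  with \<open>\<Gamma> \<noteq> {}\<close> \<Gamma>(1) show ?thesis by blast
qed

lemma maximal_imp_ex_total_not_onto:
  assumes X: "countable X" "infinite X"
    and M: "maximal_inverse_subsemigroup X M" "\<not> Sym X \<subseteq> M"
  shows "\<exists>v\<in>M. Domain v = X \<and> Range v \<noteq> X"
proof (rule ccontr)
  assume none: "\<not> (\<exists>v\<in>M. Domain v = X \<and> Range v \<noteq> X)"
  let ?T = "{f \<in> sym_inv_monoid X. Domain f = X \<longleftrightarrow> Range f = X}"
  have Mi: "inverse_subsemigroup X M" using M(1) by (auto simp: maximal_inverse_subsemigroup_def)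
  have "M \<subseteq> ?T"
  proof
    fix f assume f: "f \<in> M"
    have "f \<in> sym_inv_monoid X" "f\<inverse> \<in> M" using Mi f by (auto simp: inverse_subsemigroup_def)
    then show "f \<in> ?T" using none f by fastforce
  qed
  moreover have "f O g \<in> ?T" if f: "f \<in> ?T" and g: "g \<in> ?T" for f g
  proof -
    have c: "f \<in> sym_inv_monoid X" "g \<in> sym_inv_monoid X" using f g by auto
    have "Domain (f O g) = X \<longleftrightarrow> Domain f = X \<and> Range f \<subseteq> Domain g"
      using chart_in_carrier[OF c(1)] chart_unique_right[OF c(1)] by blast
    moreover have "Range (f O g) = X \<longleftrightarrow> Range g = X \<and> Domain g \<subseteq> Range f"
      using chart_in_carrier[OF c(2)] chart_unique_left[OF c(2)] by blast
    moreover have "Range f \<subseteq> X" "Domain g \<subseteq> X"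
      using chart_in_carrier[OF c(1)] chart_in_carrier[OF c(2)] by blast+
    moreover have "Domain f = X \<longleftrightarrow> Range f = X" "Domain g = X \<longleftrightarrow> Range g = X"
      using f g by auto
    \<comment> \<open>If the product is total, then \<open>f\<close> is total, hence onto, so
      \<open>g\<close> is total and hence onto, and the product is onto. The converse is
      dual.\<close>
    ultimately have "Domain (f O g) = X \<longleftrightarrow> Range (f O g) = X"
      by (metis subset_antisym)
    then show ?thesis using chart_comp[OF c] by simp
  qed
  then have "inverse_subsemigroup X ?T"
    by (auto simp: inverse_subsemigroup_def chart_converse)
  moreover obtain a where "a \<in> X" using X(2) by fastforce
  \<comment> \<open>A total chart missing exactly one point shows that \<open>?T\<close> is
    proper.\<close>
  then obtain p where p: "p \<in> sym_inv_monoid X" "Domain p = X" "Range p = X - {a}"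
    using ex_total_chart_fixing[of X "X - {a}" "{}"] X by auto
  have "p \<notin> ?T" using p \<open>a \<in> X\<close> by auto
  then have "?T \<noteq> sym_inv_monoid X" using p(1) by metis
  ultimately have "?T = M"
    using M(1)[unfolded maximal_inverse_subsemigroup_def] by (elim conjE allE[of _ ?T] mp) simp
  then have "Sym X \<subseteq> M" by (auto simp: Sym_def)
  with M(2) show False ..
qed

theorem corollary3p25:
  fixes X \<Sigma> :: "'a set"
  assumes "countable X" and "infinite X"
    and "\<Sigma> \<subseteq> X" and "finite \<Sigma>" and "\<Sigma> \<noteq> {}"
  shows "{M. maximal_inverse_subsemigroup X M \<and> pointwise_stabiliser X \<Sigma> \<subseteq> M \<and> \<not> Sym X \<subseteq> M} =
    {P_semigroup X \<Gamma> | \<Gamma>. \<Gamma> \<noteq> {} \<and> \<Gamma> \<subseteq> \<Sigma>} \<union> {Q_semigroup X \<Gamma> | \<Gamma>. \<Gamma> \<noteq> {} \<and> \<Gamma> \<subseteq> \<Sigma>}"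
    (is "?L = ?R")
proof (intro equalityI subsetI)
  fix M assume "M \<in> ?L"
  then have max: "maximal_inverse_subsemigroup X M"
    and M: "pointwise_stabiliser X \<Sigma> \<subseteq> M" "\<not> Sym X \<subseteq> M" by auto
  then have Mi: "inverse_subsemigroup X M" by (simp add: maximal_inverse_subsemigroup_def)
  \<comment> \<open>Between maximal semigroups containment is equality, so it remains to place
    \<open>M\<close> inside one of the listed ones.\<close>
  have eq: "M = N" if "M \<subseteq> N" "maximal_inverse_subsemigroup X N" for N
    using max that unfolding maximal_inverse_subsemigroup_def by blast
  show "M \<in> ?R"
  proof (cases "\<exists>\<Gamma>. \<Gamma> \<noteq> {} \<and> \<Gamma> \<subseteq> \<Sigma> \<and> M \<subseteq> Q_semigroup X \<Gamma>")
    case True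
    then obtain \<Gamma> where \<Gamma>: "\<Gamma> \<noteq> {}" "\<Gamma> \<subseteq> \<Sigma>" "M \<subseteq> Q_semigroup X \<Gamma>" by blast
    moreover have "\<Gamma> \<subseteq> X" "finite \<Gamma>" using \<Gamma>(2) assms(3,4) finite_subset by auto
    ultimately have "M = Q_semigroup X \<Gamma>" using eq maximal_Q[OF assms(1,2)] by blast
    with \<Gamma> show ?thesis by blast
  next
    case False
    obtain v where "v \<in> M" "Domain v = X" "Range v \<noteq> X"
      using maximal_imp_ex_total_not_onto[OF assms(1,2) max M(2)] by blast
    then obtain q where q: "q \<in> M" "Domain q = X" "infinite (X - Range q)"
      using ex_total_infinite_defect[OF assms(1-4) Mi M] False by blast
    then obtain \<Gamma> where \<Gamma>: "\<Gamma> \<noteq> {}" "\<Gamma> \<subseteq> \<Sigma>" "M \<subseteq> P_semigroup X \<Gamma>"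
      using total_infinite_defect_imp_subset_P[OF assms(1-4) Mi M q] by blast
    moreover have "\<Gamma> \<subseteq> X" "finite \<Gamma>" using \<Gamma>(2) assms(3,4) finite_subset by auto
    ultimately have "M = P_semigroup X \<Gamma>" using eq maximal_P[OF assms(1,2)] by blast
    with \<Gamma> show ?thesis by blast
  qed
next
  fix M assume "M \<in> ?R"
  then obtain \<Gamma> where \<Gamma>: "\<Gamma> \<noteq> {}" "\<Gamma> \<subseteq> \<Sigma>" "M = P_semigroup X \<Gamma> \<or> M = Q_semigroup X \<Gamma>"
    by blast
  then have \<Gamma>': "\<Gamma> \<subseteq> X" "finite \<Gamma>" using assms(3,4) finite_subset by auto
  have "p `` \<Gamma> = \<Gamma>" if "p \<in> pointwise_stabiliser X \<Sigma>" for p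
  proof -
    have "p \<in> sym_inv_monoid X" "\<And>y. y \<in> \<Gamma> \<Longrightarrow> (y, y) \<in> p"
      using that \<Gamma>(2) by (auto simp: pointwise_stabiliser_def Sym_def)
    then show ?thesis using chart_unique_right[of p X] by blast
  qed
  moreover have "p \<in> sym_inv_monoid X" "Domain p = X" "Range p = X"
    if "p \<in> pointwise_stabiliser X \<Sigma>" for p
    using that by (auto simp: pointwise_stabiliser_def Sym_def)
  ultimately have "p \<in> P_semigroup X \<Gamma>" "p \<in> Q_semigroup X \<Gamma>"
    if "p \<in> pointwise_stabiliser X \<Sigma>" for p
    unfolding P_semigroup_iff[OF assms(1,2)] Q_semigroup_iff[OF assms(1)] using that by auto
  then have "pointwise_stabiliser X \<Sigma> \<subseteq> M" using \<Gamma>(3) by blast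
  then show "M \<in> ?L"
    using \<Gamma>(3) maximal_P[OF assms(1,2) \<Gamma>' \<Gamma>(1)] maximal_Q[OF assms(1,2) \<Gamma>' \<Gamma>(1)]
      not_Sym_subset_P[OF assms(1,2) \<Gamma>' \<Gamma>(1)] not_Sym_subset_Q[OF assms(1,2) \<Gamma>' \<Gamma>(1)]
    by blast
qed

end
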